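(* Let $m\ge 2$ and let $h_\omega$ be the infinite $m$-bonacci word. (1) Every prefix of type-1 of $h_\omega$ is closed. (2) Every prefix of type-2 of $h_\omega$ is open.
   Context: Fix $m\ge 2$ and $A_m=\{0,1,\ldots,m-1\}$. The morphism $\varphi_m:A_m^*\to A_m^*$ is given by $\varphi_m(i)=0(i+1)$ for $0\le i\le m-2$ and $\varphi_m(m-1)=0$. Put $h_n=\varphi_m^n(0)$ for $n\ge 0$; the infinite $m$-bonacci word $h_\omega$ is the fixed point of $\varphi_m$ starting with $0$. $w^R$ is the reversal of a word $w$ and $|w|$ its length. $(u_n)_{n\ge 1}$ is the sequence of palindromic prefixes of $h_\omega$ sorted by increasing length, starting with the empty word $u_1=\varepsilon$ (so $u_2=0$). The words $t_n$: $t_1=\varepsilon$; $t_n=(n-1)\,h_0^Rh_1^R\cdots h_{n-3}^R$ for $2\le n\le m$ (here $n-1$ denotes a letter, and the product is empty for $n=2$); $t_n=h_{n-m-1}^Rh_{n-m}^R\cdots h_{n-3}^R$ for $n\ge m+1$. For a nonempty finite prefix $w$ of $h_\omega$, let $n(w)$ be the unique positive integer with $|u_{n(w)}|<|w|\le |u_{n(w)+1}|$. The prefix $w$ is of type-1 if $|u_{n(w)}|+|t_{n(w)}|<|w|\le|u_{n(w)+1}|$, and of type-2 if $|u_{n(w)}|<|w|\le|u_{n(w)}|+|t_{n(w)}|$. A word $x$ is a border of $w$ if it is nonempty and both a prefix and a suffix of $w$. A nonempty finite word $w$ is closed if it is a single letter or it has a border $x$ that occurs exactly twice in $w$ (occurrences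 may overlap); otherwise it is open. *)

theory Defs
  imports "HOL-Library.Stream" "HOL-Library.Sublist" "HOL-Library.Infinite_Set"
begin

section \<open>The m-bonacci morphism and its fixed point\<close>

text \<open>Words over the alphabet \<open>{0, \<dots>, m - 1}\<close> are lists of natural numbers.  The value of
  \<open>\<phi>\<close> outside the alphabet is irrelevant; there it is \<open>[0]\<close>, so that \<open>\<phi>\<close> is never erasing.\<close>

definition phi_letter :: "nat \<Rightarrow> nat \<Rightarrow> nat list" where
  "phi_letter m i = (if i + 1 < m then [0, i + 1] else [0])"

definition phi :: "nat \<Rightarrow> nat list \<Rightarrow> nat list" where
  "phi m w = concat (map (phi_letter m) w)"

definition phi_inf :: "nat \<Rightarrow> nat stream \<Rightarrow> nat stream" where
  "phi_inf m s = flat (smap (phi_letter m) s)"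

definition hword :: "nat \<Rightarrow> nat \<Rightarrow> nat list" where
  "hword m n = (phi m ^^ n) [0]"

text \<open>The description is proper for \<open>m \<ge> 2\<close>: see \<open>ex1_fixed_point\<close> below.\<close>

definition h_omega :: "nat \<Rightarrow> nat stream" where
  "h_omega m = (THE s. shd s = 0 \<and> phi_inf m s = s)"

definition inf_prefix :: "'a list \<Rightarrow> 'a stream \<Rightarrow> bool" where
  "inf_prefix w s \<longleftrightarrow> stake (length w) s = w"


section \<open>Palindromic prefixes and the two types of prefixes\<close>

definition pal_prefix_lengths :: "nat \<Rightarrow> nat set" where
  "pal_prefix_lengths m = {k. rev (stake k (h_omega m)) = stake k (h_omega m)}"

text \<open>A prefix is determined by its length, so sorting the palindromic prefixes amounts to
  enumerating the infinite set (see \<open>infinite_pal_prefix_lengths\<close>) of their lengths.  The sequence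
  \<open>uword\<close> starts at index 1, whereas \<open>enumerate\<close> starts at 0; the values of \<open>uword\<close> and \<open>tword\<close> at 0 are
  meaningless.\<close>

definition uword :: "nat \<Rightarrow> nat \<Rightarrow> nat list" where
  "uword m n = stake (enumerate (pal_prefix_lengths m) (n - 1)) (h_omega m)"

text \<open>The interval \<open>[a..<n - 2]\<close> lists the indices \<open>a, \<dots>, n - 3\<close>.\<close>

definition tword :: "nat \<Rightarrow> nat \<Rightarrow> nat list" where
  "tword m n =
     (if n \<le> 1 then []
      else if n \<le> m then (n - 1) # concat (map (\<lambda>j. rev (hword m j)) [0..<n - 2])
      else concat (map (\<lambda>j. rev (hword m j)) [n - m - 1..<n - 2]))"

text \<open>The index \<open>n(w)\<close>; it depends only on the length of \<open>w\<close>, and it is well defined for nonempty \<open>w\<close>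
  by \<open>ex1_pal_index\<close>.\<close>

definition pal_index :: "nat \<Rightarrow> nat list \<Rightarrow> nat" where
  "pal_index m w =
     (THE n. 0 < n \<and> length (uword m n) < length w \<and> length w \<le> length (uword m (n + 1)))"

definition type1 :: "nat \<Rightarrow> nat list \<Rightarrow> bool" where
  "type1 m w \<longleftrightarrow> w \<noteq> [] \<and> inf_prefix w (h_omega m) \<and>
     (let n = pal_index m w in
        length (uword m n) + length (tword m n) < length w \<and> length w \<le> length (uword m (n + 1)))"

definition type2 :: "nat \<Rightarrow> nat list \<Rightarrow> bool" where
  "type2 m w \<longleftrightarrow> w \<noteq> [] \<and> inf_prefix w (h_omega m) \<and>
     (let n = pal_index m w in
        length (uword m n) < length w \<and> length w \<le> length (uword m n) + length (tword m n))"


section \<open>Closed and open words\<close>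

definition border :: "'a list \<Rightarrow> 'a list \<Rightarrow> bool" where
  "border x w \<longleftrightarrow> x \<noteq> [] \<and> prefix x w \<and> suffix x w"

definition occurrences :: "'a list \<Rightarrow> 'a list \<Rightarrow> nat set" where
  "occurrences x w = {i. i + length x \<le> length w \<and> take (length x) (drop i w) = x}"

definition closed_word :: "'a list \<Rightarrow> bool" where
  "closed_word w \<longleftrightarrow> w \<noteq> [] \<and>
     (length w = 1 \<or> (\<exists>x. border x w \<and> card (occurrences x w) = 2))"

definition open_word :: "'a list \<Rightarrow> bool" where
  "open_word w \<longleftrightarrow> w \<noteq> [] \<and> \<not> closed_word w"


section \<open>Well-definedness\<close>

lemma phi_letter_nonempty [simp]: "phi_letter m i \<noteq> []"
  by (simp add: phi_letter_def)

lemma phi_append [simp]: "phi m (v @ w) = phi m v @ phi m w"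
  by (simp add: phi_def)

lemma phi_inf_shift: "phi_inf m (w @- s) = phi m w @- phi_inf m s"
  by (induction w) (simp_all add: phi_inf_def phi_def)

lemma shd_phi_inf [simp]: "shd (phi_inf m s) = 0"
  by (simp add: phi_inf_def phi_letter_def)

lemma inf_prefix_iff: "inf_prefix w s \<longleftrightarrow> (\<exists>s'. s = w @- s')"
proof
  assume "inf_prefix w s"
  then show "\<exists>s'. s = w @- s'"
    by (metis inf_prefix_def stake_sdrop)
qed (auto simp: inf_prefix_def stake_shift)

lemma phi_inf_prefix: "inf_prefix w s \<Longrightarrow> inf_prefix (phi m w) (phi_inf m s)"
  by (auto simp: inf_prefix_iff phi_inf_shift)

lemma stream_eqI_prefixes:
  assumes "\<And>n. n < length (f n)" and "\<And>n. inf_prefix (f n) s" and "\<And>n. inf_prefix (f n) s'"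
  shows "s = s'"
proof -
  have "s !! n = s' !! n" for n
    by (metis assms inf_prefix_iff shift_snth_less)
  then show ?thesis
    using smap_alt[of id s s'] by (simp add: stream.map_id)
qed

lemma hword_0 [simp]: "hword m 0 = [0]"
  by (simp add: hword_def)

lemma hword_Suc: "hword m (Suc n) = phi m (hword m n)"
  by (simp add: hword_def)

context
  fixes m :: nat
  assumes m: "m \<ge> 2"
begin

lemma h_Suc_extends: "\<exists>v. v \<noteq> [] \<and> hword m (Suc n) = hword m n @ v"
proof (induction n)
  case 0
  then show ?case using m by (simp add: hword_Suc phi_def phi_letter_def)
next
  case (Suc n)
  then obtain v where "v \<noteq> []" "hword m (Suc n) = hword m n @ v" by blast
  then have "hword m (Suc (Suc n)) = hword m (Suc n) @ phi m v" and "phi m v \<noteq> []"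
    by (simp_all add: hword_Suc[of m "Suc n"] hword_Suc[of m n]) (cases v; simp add: phi_def)
  then show ?case by blast
qed

lemma length_h: "n < length (hword m n)"
proof (induction n)
  case (Suc n)
  then show ?case using h_Suc_extends[of n] by (auto simp: neq_Nil_conv)
qed simp

lemma prefix_h: "i \<le> j \<Longrightarrow> prefix (hword m i) (hword m j)"
proof (induction j rule: dec_induct)
  case (step j)
  then show ?case using h_Suc_extends[of j] by (metis prefix_append)
qed simp

lemma fixed_point_prefix:
  assumes "shd s = 0" "phi_inf m s = s"
  shows "inf_prefix (hword m n) s"
proof (induction n)
  case 0
  then show ?case using assms by (simp add: inf_prefix_def)
next
  case (Suc n)
  then show ?case using phi_inf_prefix[of "hword m n" s m] assms by (simp add: hword_Suc)
qed

lemma ex1_fixed_point: "\<exists>!s. shd s = 0 \<and> phi_inf m s = s"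
proof (rule ex_ex1I)
  define s where "s = smap (\<lambda>i. hword m i ! i) nats"
  have pre: "inf_prefix (hword m n) s" for n
  proof -
    have "hword m i ! i = hword m n ! i" if "i < length (hword m n)" for i
      using that length_h[of i] prefix_h[of i n] prefix_h[of n i]
      by (metis nat_le_linear nth_append prefix_def)
    then show ?thesis
      unfolding inf_prefix_def s_def by (intro nth_equalityI) simp_all
  qed
  have "inf_prefix (hword m n) (phi_inf m s)" for n
  proof (cases n)
    case 0
    then show ?thesis by (simp add: inf_prefix_def)
  next
    case (Suc k)
    then show ?thesis using phi_inf_prefix[OF pre[of k], of m] by (simp add: hword_Suc)
  qed
  then have "phi_inf m s = s"
    using stream_eqI_prefixes[of "hword m"] length_h pre by blast
  then show "\<exists>s. shd s = 0 \<and> phi_inf m s = s"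
    by (metis shd_phi_inf)
next
  fix s s'
  assume "shd s = 0 \<and> phi_inf m s = s" "shd s' = 0 \<and> phi_inf m s' = s'"
  then show "s = s'"
    using stream_eqI_prefixes[of "hword m"] length_h fixed_point_prefix by blast
qed

lemma h_omega_fixed: "shd (h_omega m) = 0" "phi_inf m (h_omega m) = h_omega m"
  using theI'[OF ex1_fixed_point] unfolding h_omega_def by blast+

lemma h_prefix_h_omega: "inf_prefix (hword m n) (h_omega m)"
  using fixed_point_prefix h_omega_fixed by blast

lemma h_omega_streams: "h_omega m \<in> streams {..<m}"
proof -
  have "sset (h_omega m) = (\<Union>i \<in> sset (h_omega m). set (phi_letter m i))"
    by (subst h_omega_fixed(2)[symmetric]) (simp add: phi_inf_def stream.set_map)
  also have "\<dots> \<subseteq> {..<m}"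
    using m by (auto simp: phi_letter_def split: if_splits)
  finally show ?thesis by (simp add: streams_iff_sset)
qed

lemma phi_rev: "phi m (rev w) @ [0] = 0 # rev (phi m w)"
proof (induction w)
  case (Cons a w)
  have "phi m (rev (a # w)) @ [0] = phi m (rev w) @ phi m [a] @ [0]" by simp
  also have "phi m [a] @ [0] = 0 # rev (phi_letter m a)"
    by (simp add: phi_def phi_letter_def)
  also have "phi m (rev w) @ 0 # rev (phi_letter m a) = (phi m (rev w) @ [0]) @ rev (phi_letter m a)"
    by simp
  also have "\<dots> = 0 # rev (phi m (a # w))"
    unfolding Cons.IH by (simp add: phi_def)
  finally show ?case .
qed (simp add: phi_def)

lemma length_phi: "length w \<le> length (phi m w)"
  by (induction w) (auto simp: phi_def phi_letter_def)

lemma ex_pal_prefix: "\<exists>w. n \<le> length w \<and> rev w = w \<and> inf_prefix w (h_omega m)"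
proof (induction n)
  case 0
  show ?case by (rule exI[of _ "[]"]) (simp add: inf_prefix_def)
next
  case (Suc n)
  then obtain w where w: "n \<le> length w" "rev w = w" "inf_prefix w (h_omega m)" by blast
  from w(3) obtain s where s: "h_omega m = w @- s" by (auto simp: inf_prefix_iff)
  have "h_omega m = phi m w @- phi_inf m s"
    by (subst h_omega_fixed(2)[symmetric]) (simp add: s phi_inf_shift)
  also have "\<dots> = (phi m w @ [0]) @- stl (phi_inf m s)"
    using shd_phi_inf[of m s] by (cases "phi_inf m s") simp
  finally have "inf_prefix (phi m w @ [0]) (h_omega m)"
    unfolding inf_prefix_iff by blast
  moreover have "rev (phi m w @ [0]) = phi m w @ [0]"
    using phi_rev[of w] w(2) by simp
  moreover have "Suc n \<le> length (phi m w @ [0])"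
    using length_phi[of w] w(1) by simp
  ultimately show ?case by blast
qed

lemma infinite_pal_prefix_lengths: "infinite (pal_prefix_lengths m)"
proof -
  have "\<exists>k\<ge>n. k \<in> pal_prefix_lengths m" for n
  proof -
    obtain w where "n \<le> length w" "rev w = w" "inf_prefix w (h_omega m)"
      using ex_pal_prefix by blast
    then show ?thesis
      unfolding inf_prefix_def pal_prefix_lengths_def by (intro exI[of _ "length w"]) simp
  qed
  then show ?thesis by (simp add: infinite_nat_iff_unbounded_le)
qed

lemma uword_1: "uword m 1 = []"
proof -
  have "0 \<in> pal_prefix_lengths m" by (simp add: pal_prefix_lengths_def)
  then show ?thesis by (simp add: uword_def enumerate_0 Least_eq_0)
qed

lemma ex1_pal_index:
  assumes "w \<noteq> []"
  shows "\<exists>!n. 0 < n \<and> length (uword m n) < length w \<and> length w \<le> length (uword m (n + 1))"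
proof -
  define e where "e = enumerate (pal_prefix_lengths m)"
  have mono: "e i < e j \<longleftrightarrow> i < j" for i j
    unfolding e_def using infinite_pal_prefix_lengths by simp
  have len: "length (uword m n) = e (n - 1)" for n
    by (simp add: uword_def e_def)
  have e0: "e 0 < length w"
    using assms uword_1 len[of 1] by simp
  define N where "N = (LEAST n. length w \<le> e n)"
  have "length w \<le> e (length w)"
    unfolding e_def using le_enumerate infinite_pal_prefix_lengths by blast
  then have N_le: "length w \<le> e N"
    unfolding N_def by (rule LeastI)
  have N: "e k < length w" if "k < N" for k
    using not_less_Least[OF that[unfolded N_def]] by simp
  have "N > 0" using N_le e0 by (cases N) auto
  show ?thesis
  proof (rule ex1I[of _ N])
    show "0 < N \<and> length (uword m N) < length w \<and> length w \<le> length (uword m (N + 1))"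
      using N N_le \<open>N > 0\<close> by (simp add: len)
  next
    fix n
    assume n: "0 < n \<and> length (uword m n) < length w \<and> length w \<le> length (uword m (n + 1))"
    then have "e (n - 1) < e N" "e (N - 1) < e n"
      using N[of "N - 1"] N_le \<open>N > 0\<close> by (simp_all add: len)
    then have "n - 1 < N" "N - 1 < n" by (simp_all add: mono)
    then show "n = N" using n \<open>N > 0\<close> by linarith
  qed
qed

end

end

theory Submission
  imports Defs
begin

text \<open>Put \<open>p\<^sub>0 = \<epsilon>\<close> and \<open>p\<^sub>k\<^sub>+\<^sub>1 = \<phi>(p\<^sub>k) 0 = h\<^sub>k p\<^sub>k\<close>.  Since the zeros of \<open>h\<^sub>\<omega>\<close> are exactly the
  first letters of the blocks \<open>\<phi>(i)\<close>, a palindromic prefix or a repeated prefix can be desubstituted.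
  By induction, the \<open>p\<^sub>k = u\<^sub>k\<^sub>+\<^sub>1\<close> are all the palindromic prefixes, and a prefix longer than
  \<open>p\<^sub>k\<close> does not reoccur before position \<open>|h\<^sub>k\<^sub>+\<^sub>1|\<close>.  As \<open>h\<^sub>k\<^sub>+\<^sub>1 p\<^sub>k\<^sub>+\<^sub>1\<close> is a prefix, the first
  return of a prefix of length in \<open>(|p\<^sub>k|, |p\<^sub>k\<^sub>+\<^sub>1|]\<close> is at position \<open>|h\<^sub>k\<^sub>+\<^sub>1|\<close> exactly.  Hence the closed
  prefixes of length at least 2 are those with length in \<open>(|p\<^sub>k| + |h\<^sub>k\<^sub>+\<^sub>1|, |p\<^sub>k\<^sub>+\<^sub>2|]\<close> for some \<open>k\<close>,
  and \<open>|t\<^sub>k\<^sub>+\<^sub>2| = |h\<^sub>k\<^sub>+\<^sub>1| - |h\<^sub>k|\<close> identifies them with the prefixes of type 1.\<close>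

lemma stake_add_shift: "stake (length w + n) (w @- s) = w @ stake n s"
  by (simp add: stake_shift)

lemma enumerate_range_strict_mono:
  fixes f :: "nat \<Rightarrow> nat"
  assumes "strict_mono f"
  shows "enumerate (range f) n = f n"
proof (induction n)
  case 0
  have "(LEAST k. k \<in> range f) = f 0"
    using assms by (intro Least_equality) (auto simp: strict_mono_less_eq)
  then show ?case by (simp add: enumerate_0)
next
  case (Suc n)
  have "infinite (range f)"
    using assms by (simp add: finite_image_iff strict_mono_imp_inj_on)
  then have "enumerate (range f) (Suc n) = (LEAST k. k \<in> range f \<and> f n < k)"
    by (simp add: enumerate_Suc'' Suc.IH)
  also have "\<dots> = f (Suc n)"
    using assms by (intro Least_equality) (auto simp: strict_mono_less strict_mono_less_eq)
  finally show ?case .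
qed

lemma phi_Nil [simp]: "phi m [] = []"
  by (simp add: phi_def)

lemma phi_Cons: "phi m (a # w) = phi_letter m a @ phi m w"
  by (simp add: phi_def)

lemma phi_inf_SCons: "phi_inf m (a ## s) = phi_letter m a @- phi_inf m s"
  using phi_inf_shift[of m "[a]" s] by (simp add: phi_Cons)

lemma phi_inf_eq_Cons: "phi_inf m s = 0 ## stl (phi_inf m s)"
  by (metis shd_phi_inf stream.collapse)

lemma sdrop_phi_inf: "sdrop (length (phi m (stake j s))) (phi_inf m s) = phi_inf m (sdrop j s)"
proof -
  have "phi_inf m s = phi m (stake j s) @- phi_inf m (sdrop j s)"
    by (metis phi_inf_shift stake_sdrop)
  then show ?thesis by (simp add: sdrop_shift)
qed

lemma zero_phi_infD:
  assumes "phi_inf m s !! i = 0"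
  shows "\<exists>j. i = length (phi m (stake j s))"
  using assms
proof (induction i arbitrary: s rule: less_induct)
  case (less i)
  obtain a s1 where s: "s = a ## s1" by (cases s)
  show ?case
  proof (cases "i = 0")
    case True
    then show ?thesis by (intro exI[of _ 0]) simp
  next
    case False
    let ?l = "length (phi_letter m a)"
    have "?l \<le> i"
      using less.prems False
      by (cases "i = 1") (auto simp: s phi_inf_SCons phi_letter_def split: if_splits)
    then have "phi_inf m s1 !! (i - ?l) = 0"
      using less.prems by (simp add: s phi_inf_SCons shift_snth_ge)
    moreover have "i - ?l < i" using False by simp
    ultimately obtain j where "i - ?l = length (phi m (stake j s1))"
      using less.IH by blast
    then have "i = length (phi m (stake (Suc j) s))"
      using \<open>?l \<le> i\<close> by (simp add: s phi_Cons)
    then show ?thesis by blast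
  qed
qed

text \<open>Reading one letter past the zero that follows the image of \<open>stake n s\<close> determines the next
  letter of \<open>s\<close> as well.\<close>

lemma phi_inf_agreeD:
  assumes "s \<in> streams {..<m}" "s' \<in> streams {..<m}"
    and "stake (length (phi m (stake n s)) + 2) (phi_inf m s)
       = stake (length (phi m (stake n s)) + 2) (phi_inf m s')"
  shows "stake (Suc n) s = stake (Suc n) s'"
  using assms
proof (induction n arbitrary: s s')
  case (0 s s')
  obtain a s1 b s1' where s: "s = a ## s1" "s' = b ## s1'" by (metis stream.exhaust)
  have "a < m" "b < m" using 0(1,2) by (auto simp: s streams_Stream)
  with 0(3) have "a = b"
    using phi_inf_eq_Cons[of m s1] phi_inf_eq_Cons[of m s1']
    by (auto simp: s phi_inf_SCons phi_letter_def numeral_2_eq_2 split: if_splits)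
  then show ?case by (simp add: s)
next
  case (Suc n s s')
  obtain a s1 b s1' where s: "s = a ## s1" "s' = b ## s1'" by (metis stream.exhaust)
  let ?N = "length (phi m (stake (Suc n) s)) + 2"
  have ab: "a < m" "b < m" using Suc.prems(1,2) by (auto simp: s streams_Stream)
  have "take 2 (stake ?N (phi_inf m s)) = take 2 (stake ?N (phi_inf m s'))"
    using Suc.prems(3) by simp
  then have "stake 2 (phi_inf m s) = stake 2 (phi_inf m s')"
    by (simp only: take_stake) (simp add: min_def)
  with ab have "a = b"
    using phi_inf_eq_Cons[of m s1] phi_inf_eq_Cons[of m s1']
    by (auto simp: s phi_inf_SCons phi_letter_def numeral_2_eq_2 split: if_splits)
  have N: "?N = length (phi_letter m a) + (length (phi m (stake n s1)) + 2)"
    by (simp add: s phi_Cons)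
  have "stake (length (phi m (stake n s1)) + 2) (phi_inf m s1)
      = stake (length (phi m (stake n s1)) + 2) (phi_inf m s1')"
    using Suc.prems(3) unfolding N
    by (simp only: s \<open>a = b\<close> phi_inf_SCons stake_add_shift) simp
  then have "stake (Suc n) s1 = stake (Suc n) s1'"
    using Suc.IH[of s1 s1'] Suc.prems(1,2) by (simp add: s streams_Stream)
  then show ?case by (simp add: s \<open>a = b\<close>)
qed

lemma phi_inj:
  assumes "set v \<subseteq> {..<m}" "set w \<subseteq> {..<m}" "length v = length w" "phi m v = phi m w"
  shows "v = w"
proof (cases "v = []")
  case False
  then have "0 < m" using assms(1) by (cases v) auto
  then have "sconst 0 \<in> streams {..<m}"
    by (simp add: streams_iff_sset)
  then have "stake (Suc (length v)) (v @- sconst 0) = stake (Suc (length v)) (w @- sconst 0)"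
    using assms by (intro phi_inf_agreeD[of _ m])
      (auto simp: streams_iff_sset phi_inf_shift stake_shift)
  then show ?thesis using assms(3) by (simp add: stake_shift take_Suc)
qed (use assms in auto)

fun pal :: "nat \<Rightarrow> nat \<Rightarrow> nat list" where
  "pal m 0 = []"
| "pal m (Suc k) = phi m (pal m k) @ [0]"

lemma pal_Suc_eq: "pal m (Suc k) = hword m k @ pal m k"
proof (induction k)
  case (Suc k)
  then show ?case by (subst pal.simps(2)) (simp add: hword_Suc del: pal.simps, simp)
qed simp

lemma length_pal_Suc: "length (pal m (Suc k)) = length (hword m k) + length (pal m k)"
  by (simp only: pal_Suc_eq length_append)

lemma hword_eq_pal_snoc: "k < m \<Longrightarrow> hword m k = pal m k @ [k]"
  by (induction k) (simp_all add: hword_Suc phi_Cons phi_letter_def)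

lemma pal_add:
  assumes "m \<ge> 2"
  shows "pal m (m + j) = hword m (m + j) @ pal m j"
proof (induction j)
  case 0
  obtain k where k: "m = Suc k" using assms by (cases m) auto
  have "hword m (Suc k) = phi m (pal m k) @ [0]"
    using hword_eq_pal_snoc[of k m] k by (simp add: hword_Suc phi_Cons phi_letter_def)
  then show ?case using k by simp
next
  case (Suc j)
  then show ?case by (simp add: hword_Suc)
qed

lemma length_concat_hword:
  "a \<le> b \<Longrightarrow> length (concat (map (\<lambda>j. rev (hword m j)) [a..<b])) + length (pal m a) = length (pal m b)"
proof (induction b rule: dec_induct)
  case (step b)
  then show ?case by (simp add: length_pal_Suc del: pal.simps)
qed simp

context
  fixes m :: nat
  assumes m: "m \<ge> 2"
begin

lemma hword_strict_mono: "length (hword m k) < length (hword m (Suc k))"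
  using h_Suc_extends[OF m, of k] by auto

lemma length_tword:
  "length (tword m (Suc (Suc k))) + length (hword m k) = length (hword m (Suc k))"
proof (cases "Suc (Suc k) \<le> m")
  case True
  then show ?thesis
    using length_concat_hword[of 0 k m] hword_eq_pal_snoc[of "Suc k" m]
    by (simp add: tword_def length_pal_Suc del: pal.simps) simp
next
  case False
  define j where "j = Suc k - m"
  have k: "Suc k = m + j" using False by (simp add: j_def)
  have "j \<le> k" using k m by simp
  then show ?thesis
    using length_concat_hword[of j k m] pal_add[OF m, of j] length_pal_Suc[of m k] False m
    by (simp add: tword_def j_def[symmetric] k[symmetric] del: pal.simps)
qed

lemma pal_prefix: "stake (length (pal m k)) (h_omega m) = pal m k"
proof -
  have "inf_prefix (pal m k) (h_omega m)"
  proof (induction k)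
    case (Suc k)
    then obtain s where "h_omega m = pal m k @- s" by (auto simp: inf_prefix_iff)
    then have "h_omega m = phi m (pal m k) @- phi_inf m s"
      by (metis h_omega_fixed(2)[OF m] phi_inf_shift)
    also have "\<dots> = pal m (Suc k) @- stl (phi_inf m s)"
      by (subst phi_inf_eq_Cons) simp
    finally show ?case unfolding inf_prefix_iff by blast
  qed (simp add: inf_prefix_def)
  then show ?thesis by (simp add: inf_prefix_def)
qed

lemma hword_prefix: "stake (length (hword m k)) (h_omega m) = hword m k"
  using h_prefix_h_omega[OF m] by (simp add: inf_prefix_def)

lemma rev_pal: "rev (pal m k) = pal m k"
proof (induction k)
  case (Suc k)
  then show ?case using phi_rev[OF m, of "pal m k"] by simp
qed simp

lemma strict_mono_length_pal: "strict_mono (\<lambda>k. length (pal m k))"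
  unfolding strict_mono_Suc_iff
proof
  show "length (pal m k) < length (pal m (Suc k))" for k
    unfolding length_pal_Suc using length_h[OF m, of k] by (simp del: length_greater_0_conv)
qed

lemma set_stake_h_omega: "set (stake k (h_omega m)) \<subseteq> {..<m}"
  using h_omega_streams[OF m] by (auto simp: set_conv_nth streams_iff_snth)

lemma sdrop_h_omega: "sdrop k (h_omega m) \<in> streams {..<m}"
  using h_omega_streams[OF m] by (simp add: streams_iff_snth sdrop_snth)

lemma palindromic_prefixD:
  "rev (stake k (h_omega m)) = stake k (h_omega m) \<Longrightarrow> k \<in> range (\<lambda>k. length (pal m k))"
proof (induction k rule: less_induct)
  case (less k)
  show ?case
  proof (cases k)
    case 0
    then show ?thesis by (intro range_eqI[of _ _ 0]) simp
  next
    case (Suc k')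
    let ?h = "h_omega m"
    have "?h !! k' = hd (rev (stake k ?h))"
      by (simp add: Suc stake_Suc del: stake.simps(2))
    also have "\<dots> = hd (stake k ?h)" by (simp only: less.prems)
    also have "\<dots> = 0" by (simp add: Suc h_omega_fixed(1)[OF m])
    finally have "?h !! k' = 0" .
    then obtain j where j: "k' = length (phi m (stake j ?h))"
      using zero_phi_infD[of m ?h k'] h_omega_fixed(2)[OF m] by auto
    define q where "q = stake j ?h"
    have "?h = phi m q @- phi_inf m (sdrop j ?h)"
      by (metis h_omega_fixed(2)[OF m] phi_inf_shift q_def stake_sdrop)
    then have "stake k' ?h = phi m q"
      by (metis j q_def inf_prefix_def inf_prefix_iff)
    then have p: "stake k ?h = phi m q @ [0]"
      using \<open>?h !! k' = 0\<close> by (simp add: Suc stake_Suc del: stake.simps(2))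
    then have "phi m q = phi m (rev q)"
      using less.prems phi_rev[OF m, of q] by simp
    then have "q = rev q"
      using set_stake_h_omega[of j] by (intro phi_inj[of q m "rev q"]) (simp_all add: q_def)
    moreover have "j < k"
      using j Suc length_phi[OF m, of q] by (simp add: q_def)
    ultimately obtain i where "j = length (pal m i)"
      using less.IH[of j] by (auto simp: q_def)
    then have "q = pal m i" using pal_prefix[of i] by (simp only: q_def)
    then have "k = length (pal m (Suc i))"
      using j[folded q_def] Suc by simp
    then show ?thesis by blast
  qed
qed

lemma pal_prefix_lengths_eq: "pal_prefix_lengths m = range (\<lambda>k. length (pal m k))"
  using palindromic_prefixD pal_prefix rev_pal unfolding pal_prefix_lengths_def by auto

lemma length_uword: "length (uword m (Suc n)) = length (pal m n)"
  by (simp add: uword_def pal_prefix_lengths_eq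
      enumerate_range_strict_mono[OF strict_mono_length_pal])

lemma stake_pal_return:
  "b \<le> length (pal m k) \<Longrightarrow>
    stake b (sdrop (length (hword m k)) (h_omega m)) = stake b (h_omega m)"
proof -
  assume b: "b \<le> length (pal m k)"
  have "take b (drop (length (hword m k)) (stake (length (pal m (Suc k))) (h_omega m)))
      = take b (pal m k)"
    unfolding pal_prefix by (simp only: pal_Suc_eq) simp
  also have "\<dots> = take b (stake (length (pal m k)) (h_omega m))"
    by (simp only: pal_prefix)
  finally show ?thesis
    using b by (simp add: length_pal_Suc take_stake drop_stake min_def del: pal.simps)
qed

lemma pal_return_ge:
  assumes "0 < i" "stake (Suc (length (pal m k))) (sdrop i (h_omega m)) = stake (Suc (length (pal m k))) (h_omega m)"
  shows "length (hword m (Suc k)) \<le> i"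
  using assms
proof (induction k arbitrary: i)
  case 0
  have h: "stake 2 (h_omega m) = [0, 1]"
    using hword_prefix[of 1] m by (simp add: hword_Suc phi_Cons phi_letter_def numeral_2_eq_2)
  have "i \<noteq> 1" using 0 h by (auto simp: numeral_2_eq_2 h_omega_fixed[OF m])
  then show ?case using 0 m by (simp add: hword_Suc phi_Cons phi_letter_def)
next
  case (Suc k)
  let ?h = "h_omega m"
  have "?h !! i = 0"
    using Suc.prems(2) h_omega_fixed(1)[OF m] by (simp add: sdrop_simps)
  then obtain j where j: "i = length (phi m (stake j ?h))"
    using zero_phi_infD[of m ?h i] h_omega_fixed(2)[OF m] by auto
  have "0 < j" using Suc.prems(1) j by (cases j) auto
  have "sdrop i ?h = phi_inf m (sdrop j ?h)"
    using sdrop_phi_inf[of m j ?h] h_omega_fixed(2)[OF m] j by simp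
  moreover have "Suc (length (pal m (Suc k))) = length (phi m (stake (length (pal m k)) ?h)) + 2"
    by (simp add: pal_prefix)
  ultimately have "stake (Suc (length (pal m k))) ?h = stake (Suc (length (pal m k))) (sdrop j ?h)"
    using Suc.prems(2) h_omega_streams[OF m] sdrop_h_omega[of j] h_omega_fixed(2)[OF m]
    by (intro phi_inf_agreeD[of _ m]) simp_all
  then have le: "length (hword m (Suc k)) \<le> j"
    using Suc.IH[of j] \<open>0 < j\<close> by simp
  have "stake j ?h = hword m (Suc k) @ stake (j - length (hword m (Suc k))) (sdrop (length (hword m (Suc k))) ?h)"
    using le stake_add[of "length (hword m (Suc k))" ?h "j - length (hword m (Suc k))"] hword_prefix[of "Suc k"] by simp
  then show ?case by (simp add: j hword_Suc[of m "Suc k"])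
qed

lemma occurrences_stake:
  assumes "b \<le> L"
  shows "occurrences (stake b (h_omega m)) (stake L (h_omega m)) =
    {i. i + b \<le> L \<and> stake b (sdrop i (h_omega m)) = stake b (h_omega m)}"
  using assms by (auto simp: occurrences_def take_stake drop_stake min_def)

lemma closed_word_stake_iff:
  assumes "0 < L"
  shows "closed_word (stake L (h_omega m)) \<longleftrightarrow> L = 1 \<or>
    (\<exists>k. length (pal m k) + length (hword m (Suc k)) < L \<and> L \<le> length (pal m (Suc (Suc k))))"
proof -
  let ?h = "h_omega m"
  have "(\<exists>k. length (pal m k) + length (hword m (Suc k)) < L \<and> L \<le> length (pal m (Suc (Suc k))))"
    if x: "border x (stake L ?h)" and c: "card (occurrences x (stake L ?h)) = 2" and "L \<noteq> 1" for x
  proof -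
    define b where "b = length x"
    have b: "0 < b" "b \<le> L" using x by (auto simp: b_def border_def dest: prefix_length_le)
    have xb: "x = stake b ?h"
    proof -
      obtain ys where "stake L ?h = x @ ys" using x by (auto simp: border_def prefix_def)
      then have "take b (stake L ?h) = x" by (simp add: b_def)
      then show ?thesis using b by (simp add: take_stake min_def)
    qed
    define O' where "O' = occurrences x (stake L ?h)"
    have O_eq: "O' = {i. i + b \<le> L \<and> stake b (sdrop i ?h) = stake b ?h}"
      using occurrences_stake b by (simp add: xb O'_def)
    have "drop (L - b) (stake L ?h) = x"
    proof -
      obtain ys where ys: "stake L ?h = ys @ x" using x by (auto simp: border_def suffix_def)
      have "L = length (ys @ x)" by (simp only: ys[symmetric] length_stake)
      then have "L - b = length ys" by (simp add: b_def)
      then show ?thesis by (simp only: ys) simp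
    qed
    then have "L - b \<in> O'"
      using b by (simp add: O_eq drop_stake xb)
    moreover have "0 \<in> O'" using b by (simp add: O_eq)
    ultimately have two: "{0, L - b} \<subseteq> O'" "card O' = 2" using c by (simp_all add: O'_def)
    define K where "K = (LEAST k. b \<le> length (pal m k))"
    have "b \<le> length (pal m b)"
      using strict_mono_length_pal strict_mono_imp_increasing by blast
    then have K: "b \<le> length (pal m K)" unfolding K_def by (rule LeastI)
    obtain k where k: "K = Suc k" using K b by (cases K) auto
    have lt: "length (pal m k) < b"
      using not_less_Least[of k "\<lambda>k. b \<le> length (pal m k)"] k K_def by simp
    let ?r = "length (hword m (Suc k))"
    have ge: "?r \<le> i" if i: "i \<in> O'" "0 < i" for i
    proof -
      have "take (Suc (length (pal m k))) (stake b (sdrop i ?h)) = take (Suc (length (pal m k))) (stake b ?h)"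
        using i by (simp add: O_eq)
      then show ?thesis using lt i pal_return_ge[of i k] by (simp add: take_stake min_def)
    qed
    have finO: "finite O'" using two(2) card.infinite by fastforce
    have "O' \<noteq> {0}" using two(2) by auto
    then obtain i where i: "i \<in> O'" "0 < i" using two by auto
    have "?r \<in> O'"
      using stake_pal_return[of b "Suc k"] K k ge[OF i] i by (simp add: O_eq)
    moreover have "?r \<noteq> 0" using hword_strict_mono[of k] by linarith
    ultimately have O2: "O' = {0, ?r}"
      using two finO by (intro card_subset_eq[symmetric]) auto
    have "i + b \<le> L" "L - b \<in> O'" using i two by (auto simp: O_eq)
    then have "L - b = ?r" using i O2 by auto
    then show ?thesis
      using lt K[unfolded k] b length_pal_Suc[of m "Suc k"] by (intro exI[of _ k] conjI) linarith+
  qed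
  moreover have "\<exists>x. border x (stake L ?h) \<and> card (occurrences x (stake L ?h)) = 2"
    if L: "length (pal m k) + length (hword m (Suc k)) < L" "L \<le> length (pal m (Suc (Suc k)))" for k
  proof -
    let ?r = "length (hword m (Suc k))"
    define b where "b = L - ?r"
    have b: "length (pal m k) < b" "b \<le> length (pal m (Suc k))" "L = ?r + b"
      using L by (simp_all add: b_def length_pal_Suc[of m "Suc k"] del: pal.simps)
    have ret: "stake b (sdrop ?r ?h) = stake b ?h"
      using stake_pal_return b by blast
    have "stake L ?h = stake ?r ?h @ stake b ?h"
      using b(3) ret stake_add[of ?r ?h b] by simp
    then have "suffix (stake b ?h) (stake L ?h)" by (simp add: suffix_def)
    moreover have "prefix (stake b ?h) (stake L ?h)"
      using b(3) by (metis add.commute stake_add prefixI)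
    ultimately have "border (stake b ?h) (stake L ?h)"
      using b(1) by (cases b) (auto simp: border_def)
    moreover have "occurrences (stake b ?h) (stake L ?h) = {0, ?r}"
    proof -
      have "i = 0 \<or> i = ?r" if i: "i + b \<le> L" "stake b (sdrop i ?h) = stake b ?h" for i
      proof (rule disjCI)
        assume "i \<noteq> ?r"
        then have "i < ?r" using i b by simp
        have "take (Suc (length (pal m k))) (stake b (sdrop i ?h)) = take (Suc (length (pal m k))) (stake b ?h)"
          using i by simp
        then show "i = 0"
          using b pal_return_ge[of i k] \<open>i < ?r\<close> by (cases "i = 0") (simp_all add: take_stake min_def)
      qed
      then show ?thesis using b ret by (auto simp: occurrences_stake)
    qed
    moreover have "?r \<noteq> 0" using hword_strict_mono[of k] by linarith
    ultimately show ?thesis by (intro exI[of _ "stake b ?h"]) simp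
  qed
  ultimately show ?thesis using assms unfolding closed_word_def by auto
qed

lemma pal_indexE:
  assumes "w \<noteq> []"
  obtains n where "pal_index m w = Suc n" "length (pal m n) < length w"
    "length w \<le> length (pal m (Suc n))"
proof -
  have "0 < pal_index m w \<and> length (uword m (pal_index m w)) < length w \<and>
      length w \<le> length (uword m (pal_index m w + 1))"
    unfolding pal_index_def by (rule theI'[OF ex1_pal_index[OF m assms]])
  then show ?thesis
    using that by (cases "pal_index m w") (simp_all add: length_uword del: pal.simps)
qed

lemma type1_closed:
  assumes "type1 m w"
  shows "closed_word w"
proof -
  have w: "w \<noteq> []" "stake (length w) (h_omega m) = w"
    using assms by (auto simp: type1_def inf_prefix_def)
  obtain n where n: "pal_index m w = Suc n" "length (pal m n) < length w"
    "length w \<le> length (pal m (Suc n))" using pal_indexE[OF w(1)] .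
  have "length w = 1 \<or> (\<exists>k. length (pal m k) + length (hword m (Suc k)) < length w \<and>
      length w \<le> length (pal m (Suc (Suc k))))"
  proof (cases n)
    case 0
    then have "length w = 1" using n by (simp add: le_antisym Suc_le_eq)
    then show ?thesis ..
  next
    case (Suc k)
    then have "length (pal m (Suc k)) + length (tword m (Suc (Suc k))) < length w"
      using assms n by (simp add: type1_def Let_def length_uword del: pal.simps)
    then show ?thesis
      using length_tword[of k] n(3) Suc
      by (intro disjI2 exI[of _ k]) (simp add: length_pal_Suc[of m k] del: pal.simps)
  qed
  then show ?thesis using closed_word_stake_iff[of "length w"] w by simp
qed

lemma type2_open:
  assumes "type2 m w"
  shows "open_word w"
proof -
  have w: "w \<noteq> []" "stake (length w) (h_omega m) = w"
    using assms by (auto simp: type2_def inf_prefix_def)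
  obtain n where n: "pal_index m w = Suc n" "length (pal m n) < length w"
    "length w \<le> length (pal m (Suc n))" using pal_indexE[OF w(1)] .
  have t: "length w \<le> length (pal m n) + length (tword m (Suc n))"
    using assms n by (simp add: type2_def Let_def length_uword del: pal.simps)
  obtain k where k: "n = Suc k"
    using t n(2) by (cases n) (auto simp: tword_def)
  have "length w \<noteq> 1" using n(2) k by simp
  moreover have False
    if l: "length (pal m l) + length (hword m (Suc l)) < length w" "length w \<le> length (pal m (Suc (Suc l)))" for l
  proof -
    have "length (pal m (Suc l)) < length (pal m (Suc n))"
      using l(1) n(3) hword_strict_mono[of l] by (simp add: length_pal_Suc del: pal.simps)
    moreover have "length (pal m n) < length (pal m (Suc (Suc l)))"
      using l(2) n(2) by simp
    ultimately have "l = k"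
      using k by (simp add: strict_mono_less[OF strict_mono_length_pal] del: pal.simps)
    then show False
      using l(1) t k length_tword[of k] by (simp add: length_pal_Suc del: pal.simps)
  qed
  ultimately show ?thesis
    using closed_word_stake_iff[of "length w"] w unfolding open_word_def by auto
qed

end

theorem theorem49:
  fixes m :: nat
  assumes "m \<ge> 2"
  shows "(\<forall>w. type1 m w \<longrightarrow> closed_word w) \<and> (\<forall>w. type2 m w \<longrightarrow> open_word w)"
  using type1_closed[OF assms] type2_open[OF assms] by blast

end
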